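(* Let $m\ge 1$, $n_1,\dots,n_m\ge 1$, and $\mathbb{X}=\biguplus_{r=1}^{m}\{r\}\times\mathbb{R}^{n_r}$. Suppose the posterior density at time step $k-1$ is a density on $\mathbb{X}$ of the form $$f_{k-1|k-1}(r_{k-1},x_{k-1})=f_{k-1|k-1}(r_{k-1})\,f_{k-1|k-1}(x_{k-1}|r_{k-1}),$$ and let the state evolve from time $k-1$ to time $k$ with transition density $$p(r_k,x_k|r_{k-1},x_{k-1})=\mu(r_k|r_{k-1})\,\pi(x_k|x_{k-1},r_k,r_{k-1}).$$ Then the predicted density at time step $k$ is $f_{k|k-1}(r_k,x_k)=f_{k|k-1}(r_k)f_{k|k-1}(x_k|r_k)$ with $$f_{k|k-1}(r_k)=\sum_{r_{k-1}=1}^{m}\mu(r_k|r_{k-1})f_{k-1|k-1}(r_{k-1}),$$ $$f_{k|k-1}(x_k|r_k)=\sum_{r_{k-1}=1}^{m}\alpha_{k|k-1}^{(r_k,r_{k-1})}\int_{\mathbb{R}^{n_{r_{k-1}}}}\pi(x_k|x_{k-1},r_k,r_{k-1})f_{k-1|k-1}(x_{k-1}|r_{k-1})\,dx_{k-1},$$ where $$\alpha_{k|k-1}^{(r_k,r_{k-1})}=\frac{\mu(r_k|r_{k-1})f_{k-1|k-1}(r_{k-1})}{\sum_{r'=1}^{m}\mu(r_k|r')f_{k-1|k-1}(r')}.$$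
   Context: The target state is $\tilde x=(r,x)\in\mathbb{X}$ with mode $r\in\{1,\dots,m\}$ and kinematic state $x\in\mathbb{R}^{n_r}$; the dimensions $n_r$ may differ between modes. The integral of a real-valued function $g$ on $\mathbb{X}$ is $\int_{\mathbb{X}}g(\tilde x)\,d\tilde x=\sum_{r=1}^m\int_{\mathbb{R}^{n_r}}g(r,x)\,dx$. A density on $\mathbb{X}$ is a nonnegative function with integral one. For a density $g$ on $\mathbb{X}$, $g(r)=\int_{\mathbb{R}^{n_r}}g(r,x)\,dx$ is the marginal (probability mass function) of the mode and $g(x|r)=g(r,x)/g(r)$ is the conditional density on $\mathbb{R}^{n_r}$ of the state given the mode; identities involving quantities conditioned on $r$ are asserted for those $r$ with $g(r)>0$. The function $\mu(\cdot|r_{k-1})$ is a probability mass function on $\{1,\dots,m\}$ for each $r_{k-1}$, and $\pi(\cdot|x_{k-1},r_k,r_{k-1})$ is a probability density on $\mathbb{R}^{n_{r_k}}$ for each $r_k$, $r_{k-1}$ and $x_{k-1}\in\mathbb{R}^{n_{r_{k-1}}}$ (all functions measurable). The predicted density is defined by the Chapman–Kolmogorov equation on $\mathbb{X}$: $f_{k|k-1}(\tilde x_k)=\int_{\mathbb{X}}p(\tilde x_k|\tilde x_{k-1})f_{k-1|k-1}(\tilde x_{k-1})\,d\tilde x_{k-1}$. *)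

theory Defs
  imports "HOL-Analysis.Analysis"
begin

text \<open>The dimension of the kinematic state depends on the mode, so it cannot be a type parameter:
  the space of real \<open>d\<close>-vectors is modelled by the functions on \<open>{..<d}\<close> (extended by \<open>undefined\<close>),
  and Lebesgue measure on it is the \<open>d\<close>-fold product of one-dimensional Lebesgue measure.\<close>

definition lebesgue_vec :: "nat \<Rightarrow> (nat \<Rightarrow> real) measure" where
  "lebesgue_vec d = (\<Pi>\<^sub>M i\<in>{..<d}. lborel)"

definition hybrid_space :: "nat \<Rightarrow> (nat \<Rightarrow> nat) \<Rightarrow> (nat \<times> (nat \<Rightarrow> real)) set" where
  "hybrid_space m n = (SIGMA r:{1..m}. space (lebesgue_vec (n r)))"

definition hybrid_integral ::
    "nat \<Rightarrow> (nat \<Rightarrow> nat) \<Rightarrow> (nat \<times> (nat \<Rightarrow> real) \<Rightarrow> real) \<Rightarrow> real" where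
  "hybrid_integral m n g = (\<Sum>r=1..m. \<integral>x. g (r, x) \<partial>lebesgue_vec (n r))"

text \<open>Integrability (which includes measurability) is required explicitly, because the Bochner
  integral of a non-integrable function is \<open>0\<close> by convention.\<close>

definition vec_density :: "nat \<Rightarrow> ((nat \<Rightarrow> real) \<Rightarrow> real) \<Rightarrow> bool" where
  "vec_density d g \<longleftrightarrow>
     (\<forall>x\<in>space (lebesgue_vec d). 0 \<le> g x) \<and>
     integrable (lebesgue_vec d) g \<and>
     (\<integral>x. g x \<partial>lebesgue_vec d) = 1"

definition hybrid_density ::
    "nat \<Rightarrow> (nat \<Rightarrow> nat) \<Rightarrow> (nat \<times> (nat \<Rightarrow> real) \<Rightarrow> real) \<Rightarrow> bool" where
  "hybrid_density m n g \<longleftrightarrow>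
     (\<forall>z\<in>hybrid_space m n. 0 \<le> g z) \<and>
     (\<forall>r\<in>{1..m}. integrable (lebesgue_vec (n r)) (\<lambda>x. g (r, x))) \<and>
     hybrid_integral m n g = 1"

definition mode_pmf :: "nat \<Rightarrow> (nat \<Rightarrow> real) \<Rightarrow> bool" where
  "mode_pmf m w \<longleftrightarrow> (\<forall>r\<in>{1..m}. 0 \<le> w r) \<and> (\<Sum>r=1..m. w r) = 1"

definition mode_marginal ::
    "(nat \<Rightarrow> nat) \<Rightarrow> (nat \<times> (nat \<Rightarrow> real) \<Rightarrow> real) \<Rightarrow> nat \<Rightarrow> real" where
  "mode_marginal n g r = (\<integral>x. g (r, x) \<partial>lebesgue_vec (n r))"

text \<open>Meaningful only if the mode has positive probability; otherwise the value is \<open>0\<close>,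
  by division by zero.\<close>

definition state_conditional ::
    "(nat \<Rightarrow> nat) \<Rightarrow> (nat \<times> (nat \<Rightarrow> real) \<Rightarrow> real) \<Rightarrow> (nat \<Rightarrow> real) \<Rightarrow> nat \<Rightarrow> real" where
  "state_conditional n g x r = g (r, x) / mode_marginal n g r"

text \<open>Every hybrid function factorizes into its marginal and its conditional on the modes of positive
  probability, so assuming this form of a density is no restriction.\<close>

lemma marginal_conditional_factorization:
  assumes "mode_marginal n g r > 0"
  shows "g (r, x) = mode_marginal n g r * state_conditional n g x r"
  using assms by (simp add: state_conditional_def)

text \<open>Chapman-Kolmogorov equation; \<open>p z z'\<close> is the transition density from \<open>z'\<close> to \<open>z\<close>.
  If the integral over the states of some mode diverges (only for \<open>z\<close> in a null set when the initial
  density and the transition densities are densities), that mode contributes \<open>0\<close>.\<close>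

definition predicted_density ::
    "nat \<Rightarrow> (nat \<Rightarrow> nat) \<Rightarrow> (nat \<times> (nat \<Rightarrow> real) \<Rightarrow> nat \<times> (nat \<Rightarrow> real) \<Rightarrow> real) \<Rightarrow>
     (nat \<times> (nat \<Rightarrow> real) \<Rightarrow> real) \<Rightarrow> nat \<times> (nat \<Rightarrow> real) \<Rightarrow> real" where
  "predicted_density m n p f z = hybrid_integral m n (\<lambda>z'. p z z' * f z')"

definition mixing_weight ::
    "nat \<Rightarrow> (nat \<Rightarrow> nat \<Rightarrow> real) \<Rightarrow> (nat \<Rightarrow> real) \<Rightarrow> nat \<Rightarrow> nat \<Rightarrow> real" where
  "mixing_weight m \<mu> w r r' = \<mu> r r' * w r' / (\<Sum>s=1..m. \<mu> r s * w s)"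

end

theory Submission imports Defs begin

text \<open>Since \<mu> does not depend on the kinematic states, it leaves the inner integral, and
  the Chapman-Kolmogorov equation becomes
  \<open>F (r, x) = (\<Sum>r'=1..m. \<mu> r r' * I r x r')\<close>, where \<open>I r x r'\<close>
  pushes the part of \<open>f\<close> on mode \<open>r'\<close> through the kernel \<pi>. By Fubini
  a Markov kernel preserves mass (\<open>markov_kernel_integral\<close>), so integrating over
  \<open>x\<close> turns \<open>I r x r'\<close> into the old mode probability \<open>w r'\<close>.
  This gives the new marginal \<open>S r\<close>, and summing over \<open>r\<close> gives total mass
  1. The conditional is the quotient of the two expressions: multiplying and dividing each summand
  by \<open>w r'\<close> turns the coefficient into the mixing weight and \<open>f\<close> into its
  conditional. Modes with \<open>w r' = 0\<close> are handled by
  \<open>integral_mult_eq_0\<close>.\<close>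

lemma sigma_finite_lebesgue_vec: "sigma_finite_measure (lebesgue_vec d)"
proof -
  interpret finite_product_sigma_finite "\<lambda>_. lborel :: real measure" "{..<d}"
    by standard auto
  show ?thesis
    unfolding lebesgue_vec_def by (rule sigma_finite_measure_axioms)
qed

lemma mem_hybrid_space_iff:
  "(r, x) \<in> hybrid_space m n \<longleftrightarrow> r \<in> {1..m} \<and> x \<in> space (lebesgue_vec (n r))"
  by (simp add: hybrid_space_def)

text \<open>Mass conservation: integrating first over the target variable \<open>x\<close> replaces
  the kernel by 1. \<open>K x y * f y\<close> is integrable on the product because the same
  computation applied to its absolute value leaves the integral of the absolute value of
  \<open>f\<close>.\<close>

lemma markov_kernel_integral:
  fixes K :: "'a \<Rightarrow> 'b \<Rightarrow> real" and f :: "'b \<Rightarrow> real"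
  assumes "sigma_finite_measure M" "sigma_finite_measure N"
    and K: "(\<lambda>(x, y). K x y) \<in> borel_measurable (M \<Otimes>\<^sub>M N)"
    and K_nonneg: "\<And>x y. x \<in> space M \<Longrightarrow> y \<in> space N \<Longrightarrow> 0 \<le> K x y"
    and K_int: "\<And>y. y \<in> space N \<Longrightarrow> integrable M (\<lambda>x. K x y)"
    and K_one: "\<And>y. y \<in> space N \<Longrightarrow> (\<integral>x. K x y \<partial>M) = 1"
    and f: "integrable N f"
  shows "integrable M (\<lambda>x. \<integral>y. K x y * f y \<partial>N)"
    and "(\<integral>x. (\<integral>y. K x y * f y \<partial>N) \<partial>M) = (\<integral>y. f y \<partial>N)"
proof -
  interpret N: sigma_finite_measure N by fact
  interpret M: sigma_finite_measure M by fact
  interpret pair_sigma_finite N M ..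
  have [measurable]: "(\<lambda>(y, x). K x y) \<in> borel_measurable (N \<Otimes>\<^sub>M M)"
    using measurable_pair_swap[OF K] by (simp add: case_prod_beta')
  have [measurable]: "f \<in> borel_measurable N"
    using f by auto
  \<comment> \<open>The source variable \<open>y\<close> comes first in the product because
    \<open>Fubini_integrable\<close> integrates the norm over the second variable, and it is in
    \<open>x\<close> that the kernel has known mass 1.\<close>
  have "integrable (N \<Otimes>\<^sub>M M) (\<lambda>(y, x). K x y * f y)"
  proof (rule Fubini_integrable)
    show "(\<lambda>(y, x). K x y * f y) \<in> borel_measurable (N \<Otimes>\<^sub>M M)"
      by measurable
    have "(\<integral>x. norm (case (y, x) of (y, x) \<Rightarrow> K x y * f y) \<partial>M) = \<bar>f y\<bar>" if "y \<in> space N" for y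
    proof -
      have "(\<integral>x. norm (case (y, x) of (y, x) \<Rightarrow> K x y * f y) \<partial>M) = (\<integral>x. K x y * \<bar>f y\<bar> \<partial>M)"
        using K_nonneg that by (intro Bochner_Integration.integral_cong) (auto simp: abs_mult)
      then show ?thesis
        using K_one[OF that] by simp
    qed
    then show "integrable N (\<lambda>y. \<integral>x. norm (case (y, x) of (y, x) \<Rightarrow> K x y * f y) \<partial>M)"
      using f by (subst Bochner_Integration.integrable_cong[OF refl, where g = "\<lambda>y. \<bar>f y\<bar>"]) auto
    show "AE y in N. integrable M (\<lambda>x. case (y, x) of (y, x) \<Rightarrow> K x y * f y)"
      using K_int by (intro AE_I2) auto
  qed
  note int = this
  show "integrable M (\<lambda>x. \<integral>y. K x y * f y \<partial>N)"
    using integrable_snd[OF int] .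
  have "(\<integral>x. (\<integral>y. K x y * f y \<partial>N) \<partial>M) = (\<integral>y. (\<integral>x. K x y * f y \<partial>M) \<partial>N)"
    using Fubini_integral[OF int] .
  also have "\<dots> = (\<integral>y. f y \<partial>N)"
    using K_one by (intro Bochner_Integration.integral_cong) auto
  finally show "(\<integral>x. (\<integral>y. K x y * f y \<partial>N) \<partial>M) = (\<integral>y. f y \<partial>N)" .
qed

text \<open>A nonnegative function with integral zero vanishes almost everywhere, and so does its
  product with any factor. Applied to \<open>f\<close> on a mode of probability 0, this shows that
  the mode contributes nothing to the prediction at any point.\<close>

lemma integral_mult_eq_0:
  fixes f g :: "'a \<Rightarrow> real"
  assumes "integrable M f" "\<And>x. x \<in> space M \<Longrightarrow> 0 \<le> f x" "(\<integral>x. f x \<partial>M) = 0"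
  shows "(\<integral>x. g x * f x \<partial>M) = 0"
proof (rule integral_eq_zero_AE)
  have "AE x in M. f x = 0"
    using assms by (subst integral_nonneg_eq_0_iff_AE[symmetric]) auto
  then show "AE x in M. g x * f x = 0"
    by eventually_elim simp
qed

theorem lemma1:
  fixes m :: nat and n :: "nat \<Rightarrow> nat"
    and f :: "nat \<times> (nat \<Rightarrow> real) \<Rightarrow> real"
    and p :: "nat \<times> (nat \<Rightarrow> real) \<Rightarrow> nat \<times> (nat \<Rightarrow> real) \<Rightarrow> real"
    and \<mu> :: "nat \<Rightarrow> nat \<Rightarrow> real"
    and \<pi> :: "(nat \<Rightarrow> real) \<Rightarrow> (nat \<Rightarrow> real) \<Rightarrow> nat \<Rightarrow> nat \<Rightarrow> real"
  assumes "m \<ge> 1"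
    and "\<And>r. r \<in> {1..m} \<Longrightarrow> n r \<ge> 1"
    and "hybrid_density m n f"
    and "\<And>r x. (r, x) \<in> hybrid_space m n \<Longrightarrow> mode_marginal n f r > 0 \<Longrightarrow>
           f (r, x) = mode_marginal n f r * state_conditional n f x r"
    and "\<And>r'. r' \<in> {1..m} \<Longrightarrow> mode_pmf m (\<lambda>r. \<mu> r r')"
    and "\<And>r r' x'. r \<in> {1..m} \<Longrightarrow> (r', x') \<in> hybrid_space m n \<Longrightarrow>
           vec_density (n r) (\<lambda>x. \<pi> x x' r r')"
    and "\<And>r r'. r \<in> {1..m} \<Longrightarrow> r' \<in> {1..m} \<Longrightarrow>
           (\<lambda>(x, x'). \<pi> x x' r r')
             \<in> borel_measurable (lebesgue_vec (n r) \<Otimes>\<^sub>M lebesgue_vec (n r'))"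
    and "\<And>r x r' x'. (r, x) \<in> hybrid_space m n \<Longrightarrow> (r', x') \<in> hybrid_space m n \<Longrightarrow>
           p (r, x) (r', x') = \<mu> r r' * \<pi> x x' r r'"
  shows "(hybrid_density m n (predicted_density m n p f)) \<and>
         (\<forall>(r, x) \<in> hybrid_space m n. mode_marginal n (predicted_density m n p f) r > 0 \<longrightarrow>
           predicted_density m n p f (r, x) =
             mode_marginal n (predicted_density m n p f) r *
             state_conditional n (predicted_density m n p f) x r) \<and>
         (\<forall>r\<in>{1..m}. mode_marginal n (predicted_density m n p f) r =
           (\<Sum>r'=1..m. \<mu> r r' * mode_marginal n f r')) \<and>
         (\<forall>(r, x) \<in> hybrid_space m n. mode_marginal n (predicted_density m n p f) r > 0 \<longrightarrow>
           state_conditional n (predicted_density m n p f) x r =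
             (\<Sum>r'=1..m. mixing_weight m \<mu> (mode_marginal n f) r r' *
                (\<integral>x'. \<pi> x x' r r' * state_conditional n f x' r' \<partial>lebesgue_vec (n r'))))"
proof -
  note f = assms(3) and mu = assms(5) and pi = assms(6) and meas = assms(7) and p = assms(8)
  define w where "w = mode_marginal n f"
  define F where "F = predicted_density m n p f"
  \<comment> \<open>Built from the joint \<open>f\<close> instead of its conditional, so that no
    division by a possibly zero \<open>w r'\<close> occurs before the final identity.\<close>
  define I where "I r x r' = (\<integral>x'. \<pi> x x' r r' * f (r', x') \<partial>lebesgue_vec (n r'))" for r x r'
  define S where "S r = (\<Sum>r'=1..m. \<mu> r r' * w r')" for r
  have f_nonneg: "f (r, x) \<ge> 0" if "(r, x) \<in> hybrid_space m n" for r x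
    using f that by (auto simp: hybrid_density_def)
  have f_int: "integrable (lebesgue_vec (n r)) (\<lambda>x. f (r, x))" if "r \<in> {1..m}" for r
    using f that by (auto simp: hybrid_density_def)
  have mu_nonneg: "\<mu> r r' \<ge> 0" if "r \<in> {1..m}" "r' \<in> {1..m}" for r r'
    using mu[OF that(2)] that(1) by (auto simp: mode_pmf_def)
  have pi_nonneg: "\<pi> x x' r r' \<ge> 0"
    if "(r, x) \<in> hybrid_space m n" "(r', x') \<in> hybrid_space m n" for r x r' x'
    using pi[of r r' x'] that by (auto simp: vec_density_def mem_hybrid_space_iff)
  have I_nonneg: "I r x r' \<ge> 0" if "(r, x) \<in> hybrid_space m n" "r' \<in> {1..m}" for r x r'
    unfolding I_def using that
    by (intro Bochner_Integration.integral_nonneg mult_nonneg_nonneg pi_nonneg f_nonneg)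
       (auto simp: mem_hybrid_space_iff)
  have I_integrable: "integrable (lebesgue_vec (n r)) (\<lambda>x. I r x r')"
    and I_integral: "(\<integral>x. I r x r' \<partial>lebesgue_vec (n r)) = w r'"
    if r: "r \<in> {1..m}" and r': "r' \<in> {1..m}" for r r'
  proof -
    have dens: "vec_density (n r) (\<lambda>x. \<pi> x x' r r')" if "x' \<in> space (lebesgue_vec (n r'))" for x'
      using pi r r' that by (auto simp: mem_hybrid_space_iff)
    note kernel = markov_kernel_integral[OF sigma_finite_lebesgue_vec sigma_finite_lebesgue_vec
        meas[OF r r'] _ _ _ f_int[OF r']]
    show "integrable (lebesgue_vec (n r)) (\<lambda>x. I r x r')"
      unfolding I_def by (rule kernel(1)) (use dens in \<open>auto simp: vec_density_def\<close>)
    show "(\<integral>x. I r x r' \<partial>lebesgue_vec (n r)) = w r'"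
      unfolding I_def w_def mode_marginal_def
      by (rule kernel(2)) (use dens in \<open>auto simp: vec_density_def\<close>)
  qed
  \<comment> \<open>This holds at every point, also where an inner integral diverges: pulling the
    constant \<open>\<mu> r r'\<close> out of a Bochner integral is valid there too, both sides
    being 0.\<close>
  have F_eq: "F (r, x) = (\<Sum>r'=1..m. \<mu> r r' * I r x r')" if "(r, x) \<in> hybrid_space m n" for r x
    unfolding F_def predicted_density_def hybrid_integral_def I_def
  proof (rule sum.cong[OF refl])
    fix r' assume r': "r' \<in> {1..m}"
    have "(\<integral>x'. p (r, x) (r', x') * f (r', x') \<partial>lebesgue_vec (n r'))
        = (\<integral>x'. \<mu> r r' * (\<pi> x x' r r' * f (r', x')) \<partial>lebesgue_vec (n r'))"
      using p[OF that] r'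
      by (intro Bochner_Integration.integral_cong) (auto simp: mem_hybrid_space_iff)
    then show "(\<integral>x'. p (r, x) (r', x') * f (r', x') \<partial>lebesgue_vec (n r'))
        = \<mu> r r' * (\<integral>x'. \<pi> x x' r r' * f (r', x') \<partial>lebesgue_vec (n r'))"
      by simp
  qed
  \<comment> \<open>Inner integrals may diverge for individual \<open>x\<close>, but by the kernel
    lemma each \<open>I r x r'\<close> is integrable as a function of \<open>x\<close>, and hence so
    is the finite sum.\<close>
  have F_int: "integrable (lebesgue_vec (n r)) (\<lambda>x. F (r, x))" if "r \<in> {1..m}" for r
  proof -
    have "integrable (lebesgue_vec (n r)) (\<lambda>x. \<Sum>r'=1..m. \<mu> r r' * I r x r')"
      using I_integrable that by auto
    moreover have "F (r, x) = (\<Sum>r'=1..m. \<mu> r r' * I r x r')"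
      if "x \<in> space (lebesgue_vec (n r))" for x
      using F_eq \<open>r \<in> {1..m}\<close> that by (simp add: mem_hybrid_space_iff)
    ultimately show ?thesis
      by (subst Bochner_Integration.integrable_cong[OF refl]) auto
  qed
  have F_marginal: "mode_marginal n F r = S r" if "r \<in> {1..m}" for r
  proof -
    have "mode_marginal n F r
        = (\<integral>x. (\<Sum>r'=1..m. \<mu> r r' * I r x r') \<partial>lebesgue_vec (n r))"
      unfolding mode_marginal_def using F_eq that
      by (intro Bochner_Integration.integral_cong) (auto simp: mem_hybrid_space_iff)
    also have "\<dots> = (\<Sum>r'=1..m. \<integral>x. \<mu> r r' * I r x r' \<partial>lebesgue_vec (n r))"
      using I_integrable that by (intro Bochner_Integration.integral_sum) auto
    also have "\<dots> = S r"
      using I_integral that by (simp add: S_def)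
    finally show ?thesis .
  qed
  have "hybrid_integral m n F = 1"
  proof -
    have "hybrid_integral m n F = (\<Sum>r=1..m. S r)"
      using F_marginal by (simp add: hybrid_integral_def mode_marginal_def)
    \<comment> \<open>After the swap the inner sum runs over the new mode \<open>r\<close>, the
      variable in which \<mu> is a probability mass function.\<close>
    also have "\<dots> = (\<Sum>r'=1..m. \<Sum>r=1..m. \<mu> r r' * w r')"
      unfolding S_def by (rule sum.swap)
    also have "\<dots> = (\<Sum>r'=1..m. (\<Sum>r=1..m. \<mu> r r') * w r')"
      by (simp add: sum_distrib_right)
    also have "\<dots> = (\<Sum>r'=1..m. w r')"
      using mu by (simp add: mode_pmf_def)
    also have "\<dots> = 1"
      using f by (simp add: hybrid_density_def hybrid_integral_def w_def mode_marginal_def)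
    finally show ?thesis .
  qed
  moreover have "F z \<ge> 0" if "z \<in> hybrid_space m n" for z
  proof (cases z)
    case (Pair r x)
    then show ?thesis
      using that mu_nonneg I_nonneg
      by (auto simp: F_eq mem_hybrid_space_iff intro!: sum_nonneg mult_nonneg_nonneg)
  qed
  ultimately have "hybrid_density m n F"
    using F_int by (simp add: hybrid_density_def)
  \<comment> \<open>Here the identity is obtained for every mode. If \<open>S r = 0\<close>, the
    conditional and all mixing weights are quotients by zero, so both sides are 0.\<close>
  moreover have "state_conditional n F x r =
      (\<Sum>r'=1..m. mixing_weight m \<mu> w r r' *
         (\<integral>x'. \<pi> x x' r r' * state_conditional n f x' r' \<partial>lebesgue_vec (n r')))"
    if rx: "(r, x) \<in> hybrid_space m n" for r x
  proof -
    have r: "r \<in> {1..m}"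
      using rx by (simp add: mem_hybrid_space_iff)
    have "state_conditional n F x r = (\<Sum>r'=1..m. \<mu> r r' * I r x r' / S r)"
      by (simp add: state_conditional_def F_eq[OF rx] F_marginal[OF r] sum_divide_distrib)
    also have "\<dots> = (\<Sum>r'=1..m. mixing_weight m \<mu> w r r' * (I r x r' / w r'))"
    proof (rule sum.cong[OF refl])
      fix r' assume r': "r' \<in> {1..m}"
      \<comment> \<open>On a mode of probability \<open>0\<close>, \<open>f\<close> vanishes almost everywhere, so dividing by zero does no harm.\<close>
      have "I r x r' = 0" if "w r' = 0"
        unfolding I_def
        by (rule integral_mult_eq_0[OF f_int[OF r']])
           (use f_nonneg r' that in \<open>auto simp: mem_hybrid_space_iff w_def mode_marginal_def\<close>)
      then show "\<mu> r r' * I r x r' / S r = mixing_weight m \<mu> w r r' * (I r x r' / w r')"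
        by (cases "w r' = 0") (simp_all add: mixing_weight_def S_def)
    qed
    \<comment> \<open>The constant divisor \<open>w r'\<close> moves under the integral, where it
      turns \<open>f (r', x')\<close> into the conditional.\<close>
    also have "\<dots> = (\<Sum>r'=1..m. mixing_weight m \<mu> w r r' *
         (\<integral>x'. \<pi> x x' r r' * state_conditional n f x' r' \<partial>lebesgue_vec (n r')))"
      by (simp add: I_def state_conditional_def w_def)
    finally show ?thesis .
  qed
  ultimately show ?thesis
    using F_marginal marginal_conditional_factorization[of n F]
    by (auto simp: F_def S_def w_def)
qed

end
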